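(* Let $\mathcal{L}_{i,j}$ be a chain with $n=|i|\geqslant 1$, let $\mathcal{F}_n$ be the $n$th Farey sequence (the reduced fractions in $[0,1]$ with denominator at most $n$), and let $\mathcal{F}=\mathcal{F}_n\cap[\theta^-,\theta^+]$. Then: (i) The set of rotation numbers $\mathcal{F}$ partitions $\mathcal{L}_{i,j}$ into $|\mathcal{F}|-1$ critical curves, themselves segments, separated by $|\mathcal{F}|$ Farey points; that is, the Farey points of $\mathcal{L}_{i,j}$ are exactly the points of $\mathcal{L}_{i,j}$ with $\theta\in\mathcal{F}$, and the critical curves on $\mathcal{L}_{i,j}$ are exactly the open segments of $\mathcal{L}_{i,j}$ between Farey points with consecutive $\theta\in\mathcal F$. (ii) Assume that $\mathcal{L}_{i,j}$ is positive ($i>0$). Let $\theta=p/q\in\mathcal{F}$ (in lowest terms), let $w=w_0\cdots w_{n-1}$ be the boundary word of length $n$ of the chain at the point with rotation number $p/q$, and let $w^{+}$ and $w^-$ be the critical words (of length $n$) of the critical curves of $\mathcal{L}_{i,j}$ adjacent to that point on the right and on the left, respectively ($w^{+}$ is missing at $\theta=\theta^+$ and $w^-$ is missing at $\theta=\theta^-$). Then for $k=1,\ldots,n-1$ the following holds: 1) At $\theta=\theta^-$ we have $w=b^n$, and $w_k^+=a$ if and only if $k\equiv 0\pmod q$. This holds also for $k=0$. 2) At $\theta=\theta^+$ we have $w=a^n$, and $w_k^-=b$ if and only if $k\equiv 0\pmod q$. 3) For $\theta\in\mathcal{F}\setminus\{\theta^-,\theta^+\}$ we have: $\alpha$) ($w_k=b$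 and $w_k^-=w_k\neq w_k^+$) if and only if $k\equiv n\pmod q$; $\beta$) ($w_k=a$ and $w_k^-\neq w_k=w_k^+$) if and only if $k\equiv 0\pmod q$. If $\mathcal{L}_{i,j}$ is negative ($i<0$), the same statements 1), 2), 3) hold with all letters $a$ and $b$ exchanged.
   Context: Rotation and coding. For $(\theta,\rho)\in[0,1]^2$ let $\mathrm{g}:[0,1)\to[0,1)$, $x\mapsto\{x+\theta\}$ ($\{\cdot\}$ = fractional part), with the partition $I_a=[0,\rho)$, $I_b=[\rho,1)$, which codes each orbit by letters $a,b$. In phase space the values $\theta=1$, $\rho=1$ are represented by their fractional part $0$ (so for $\rho=0$ every symbol is $b$; for $\rho=1$ every symbol is $a$ and the boundary point $\rho$ is the point $0$). Chains. For $(i,j)\in\mathbb{Z}^2$ with $0\leqslant j\leqslant i-1$ if $i>0$, $-1\leqslant j\leqslant 0$ if $i=0$, $i\leqslant j\leqslant -1$ if $i<0$, the chain with affine parameters $(i,j)$ is $\mathcal{L}_{i,j}=\{(\theta,\rho)\in[0,1]^2: \rho=i\theta-j\}$. For $i\neq0$ it is the segment $\theta^-\leqslant\theta\leqslant\theta^+$, where $\theta^-=j/i$ if $i>0$, $\theta^-=(j+1)/i$ if $i<0$, and $\theta^+=\theta^-+1/|i|$. $\mathcal{L}_{0,0}$ is the segment $\rho=0$ and $\mathcal{L}_{0,-1}$ the segment $\rho=1$ ($0\leqslant\theta\leqslant1$). The chain is positive if $i>0$, negative if $i<0$; for $i=0$ it is both. Boundary words on a chain. Let $i\neq 0$, $n=|i|$.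 At a point $(\theta,\rho)\in\mathcal{L}_{i,j}$ the boundary word of length $n$ is the symbol sequence of $x_0,x_1,\ldots,x_{n-1}$, $x_{k+1}=\mathrm{g}(x_k)$, where $x_0=0$ if $i>0$ (then $x_n=\rho$) and $x_0=\rho$ if $i<0$ (then $x_n=0$), with $\rho=1$ identified with $0$. Critical words. The critical word at a point $(\theta,\rho)$ of $\mathcal{L}_{i,j}$ is the boundary word of minimal length with the sign of the chain: if $\rho\in\{0,1\}$ it is the empty word $\varepsilon$; if $\rho\neq0,1$ and $i>0$ it is the symbol sequence of the orbit starting at $0$ up to, but excluding, its first visit to $\rho$; if $\rho\neq 0,1$ and $i<0$ it is the symbol sequence of the orbit starting at $\rho$ up to, but excluding, its first visit to $0$. Critical curves and Farey points. A chain is partitioned into maximal connected subsets on which the critical word is constant; such a subset is called a critical curve if it has more than one point, and a Farey point if it is a single point. *)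

theory Defs
  imports "HOL-Analysis.Analysis" "HOL-Library.Disjoint_Sets" "HOL-Number_Theory.Cong"
begin

datatype letter = La | Lb

definition rotation :: "real \<Rightarrow> real \<Rightarrow> real" where
  "rotation \<theta> x = frac (x + \<theta>)"

text \<open>For phase points \<open>x\<close> in \<open>[0,1)\<close> this codes the partition \<open>[0,\<rho>)\<close>, \<open>[\<rho>,1)\<close>,
  including the degenerate cases \<open>\<rho> = 0\<close> (all \<open>b\<close>) and \<open>\<rho> = 1\<close> (all \<open>a\<close>).
  Here \<open>\<rho>\<close> is the parameter itself, whereas the boundary point in phase space
  is \<open>frac \<rho>\<close>.\<close>
definition symbol :: "real \<Rightarrow> real \<Rightarrow> letter" where
  "symbol \<rho> x = (if x < \<rho> then La else Lb)"

definition orbit_word :: "real \<Rightarrow> real \<Rightarrow> real \<Rightarrow> nat \<Rightarrow> letter list" where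
  "orbit_word \<theta> \<rho> x\<^sub>0 n = map (\<lambda>k. symbol \<rho> ((rotation \<theta> ^^ k) x\<^sub>0)) [0..<n]"

definition chain_index :: "int \<Rightarrow> int \<Rightarrow> bool" where
  "chain_index i j \<longleftrightarrow>
     (i > 0 \<and> 0 \<le> j \<and> j \<le> i - 1) \<or>
     (i = 0 \<and> -1 \<le> j \<and> j \<le> 0) \<or>
     (i < 0 \<and> i \<le> j \<and> j \<le> -1)"

definition chain :: "int \<Rightarrow> int \<Rightarrow> (real \<times> real) set" where
  "chain i j = {(\<theta>, \<rho>). \<theta> \<in> {0..1} \<and> \<rho> \<in> {0..1} \<and> \<rho> = of_int i * \<theta> - of_int j}"

text \<open>The following two are meaningful for \<open>i \<noteq> 0\<close> only.\<close>

definition theta_minus :: "int \<Rightarrow> int \<Rightarrow> real" where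
  "theta_minus i j = (if i > 0 then of_int j / of_int i else of_int (j + 1) / of_int i)"

definition theta_plus :: "int \<Rightarrow> int \<Rightarrow> real" where
  "theta_plus i j = theta_minus i j + 1 / of_int \<bar>i\<bar>"

definition boundary_word :: "int \<Rightarrow> real \<times> real \<Rightarrow> letter list" where
  "boundary_word i = (\<lambda>(\<theta>, \<rho>).
     orbit_word \<theta> \<rho> (if i > 0 then 0 else frac \<rho>) (nat \<bar>i\<bar>))"

text \<open>Of the chain, only the sign of \<open>i\<close> matters. Chains with \<open>i = 0\<close> consist of points with
  \<open>\<rho> = 0\<close> or \<open>\<rho> = 1\<close>, so that the last branch concerns \<open>i < 0\<close>.\<close>
definition critical_word :: "int \<Rightarrow> real \<times> real \<Rightarrow> letter list" where
  "critical_word i = (\<lambda>(\<theta>, \<rho>).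
     if \<rho> = 0 \<or> \<rho> = 1 then []
     else if i > 0 then orbit_word \<theta> \<rho> 0 (LEAST m. (rotation \<theta> ^^ m) 0 = \<rho>)
     else orbit_word \<theta> \<rho> \<rho> (LEAST m. (rotation \<theta> ^^ m) \<rho> = 0))"

definition critical_piece :: "int \<Rightarrow> int \<Rightarrow> (real \<times> real) set \<Rightarrow> bool" where
  "critical_piece i j S \<longleftrightarrow>
     S \<noteq> {} \<and> S \<subseteq> chain i j \<and> connected S \<and> critical_word i constant_on S \<and>
     (\<forall>T. S \<subseteq> T \<and> T \<subseteq> chain i j \<and> connected T \<and> critical_word i constant_on T \<longrightarrow> T = S)"

definition critical_curve :: "int \<Rightarrow> int \<Rightarrow> (real \<times> real) set \<Rightarrow> bool" where
  "critical_curve i j S \<longleftrightarrow> critical_piece i j S \<and> (\<exists>P\<in>S. \<exists>Q\<in>S. P \<noteq> Q)"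

definition farey_point :: "int \<Rightarrow> int \<Rightarrow> real \<times> real \<Rightarrow> bool" where
  "farey_point i j P \<longleftrightarrow> critical_piece i j {P}"

definition farey :: "nat \<Rightarrow> real set" where
  "farey n = {real p / real q | p q. coprime p q \<and> 1 \<le> q \<and> q \<le> n \<and> p \<le> q}"

text \<open>The critical word of a critical curve, as the common value on its points.\<close>
definition curve_word :: "int \<Rightarrow> (real \<times> real) set \<Rightarrow> letter list" where
  "curve_word i C = (THE v. \<forall>Q\<in>C. critical_word i Q = v)"

definition right_curve :: "int \<Rightarrow> int \<Rightarrow> real \<times> real \<Rightarrow> (real \<times> real) set \<Rightarrow> bool" where
  "right_curve i j P C \<longleftrightarrow>
     critical_curve i j C \<and> P \<in> closure C \<and> (\<forall>Q\<in>C. fst P < fst Q)"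

definition left_curve :: "int \<Rightarrow> int \<Rightarrow> real \<times> real \<Rightarrow> (real \<times> real) set \<Rightarrow> bool" where
  "left_curve i j P C \<longleftrightarrow>
     critical_curve i j C \<and> P \<in> closure C \<and> (\<forall>Q\<in>C. fst Q < fst P)"

text \<open>\<open>None\<close> means that there is no adjacent critical curve on the respective side.\<close>

definition right_word :: "int \<Rightarrow> int \<Rightarrow> real \<times> real \<Rightarrow> letter list option" where
  "right_word i j P =
     (if \<exists>C. right_curve i j P C then Some (curve_word i (THE C. right_curve i j P C)) else None)"

definition left_word :: "int \<Rightarrow> int \<Rightarrow> real \<times> real \<Rightarrow> letter list option" where
  "left_word i j P =
     (if \<exists>C. left_curve i j P C then Some (curve_word i (THE C. left_curve i j P C)) else None)"

end

theory Submission
  imports Defs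
begin

text \<open>Shifting phase space makes negative chains positive, so let \<open>i = n > 0\<close>. The \<open>k\<close>-th letter
  of the word of length \<open>n\<close> compares \<open>{k\<theta>}\<close> with \<open>\<rho> = n\<theta> - j\<close>; it can change only where \<open>k\<theta>\<close>
  or \<open>(n - k)\<theta>\<close> is an integer, hence only at Farey fractions of order \<open>n\<close>. There, and only
  there, the orbit of \<open>0\<close> hits \<open>\<rho>\<close> before time \<open>n\<close> (or \<open>\<rho> \<in> {0, 1}\<close>), which shortens the
  critical word and so isolates the point. For the words next to \<open>\<theta> = p/q\<close>, as \<open>\<theta>\<close> varies
  the point \<open>\<rho>\<close> moves with speed \<open>n\<close> and \<open>{k\<theta>}\<close> with the smaller speed \<open>k\<close>; a letter flips
  on one side exactly when \<open>{k\<theta>}\<close> equals \<open>\<rho>\<close> (\<open>k \<equiv> n\<close>) or \<open>0\<close> (\<open>k \<equiv> 0\<close> modulo \<open>q\<close>).\<close>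

section \<open>Finite subdivisions of a real interval\<close>

text \<open>Consecutiveness is encoded by the absence of points of \<open>F\<close> strictly between
  two of them, the form in which the endpoints of critical curves are described later.\<close>

definition gaps :: "real set \<Rightarrow> real set set" where
  "gaps F = {{u<..<v} | u v. u \<in> F \<and> v \<in> F \<and> u < v \<and> F \<inter> {u<..<v} = {}}"

lemma gapsE:
  assumes "S \<in> gaps F"
  obtains u v where "u \<in> F" "v \<in> F" "u < v" "F \<inter> {u<..<v} = {}" "S = {u<..<v}"
  using assms unfolding gaps_def by blast

lemma obtain_succ:
  fixes F :: "real set"
  assumes "finite F" "r \<in> F" "x < r"
  obtains v where "v \<in> F" "x < v" "F \<inter> {x<..<v} = {}"
proof -
  let ?G = "{y \<in> F. x < y}"
  have fin: "finite ?G" and ne: "?G \<noteq> {}" using assms by auto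
  have "Min ?G \<in> ?G" using Min_in[OF fin ne] .
  moreover have "F \<inter> {x<..<Min ?G} = {}"
    using Min_le[OF fin] by (force simp: not_less)
  ultimately show thesis using that by blast
qed

lemma obtain_pred:
  fixes F :: "real set"
  assumes "finite F" "l \<in> F" "l < x"
  obtains u where "u \<in> F" "u < x" "F \<inter> {u<..<x} = {}"
proof -
  let ?G = "{y \<in> F. y < x}"
  have fin: "finite ?G" and ne: "?G \<noteq> {}" using assms by auto
  have "Max ?G \<in> ?G" using Max_in[OF fin ne] .
  moreover have "F \<inter> {Max ?G<..<x} = {}"
    using Max_ge[OF fin] by (force simp: not_less)
  ultimately show thesis using that by blast
qed

lemma obtain_gap:
  fixes F :: "real set"
  assumes "finite F" "l \<in> F" "r \<in> F" "x \<in> {l..r}" "x \<notin> F"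
  obtains u v where "u \<in> F" "v \<in> F" "u < x" "x < v" "F \<inter> {u<..<v} = {}"
proof -
  have "l \<noteq> x" "x \<noteq> r" using assms(2,3,5) by blast+
  then have "l < x" "x < r" using assms(4) by auto
  obtain v where v: "v \<in> F" "x < v" "F \<inter> {x<..<v} = {}"
    using obtain_succ[OF assms(1,3) \<open>x < r\<close>] .
  obtain u where u: "u \<in> F" "u < x" "F \<inter> {u<..<x} = {}"
    using obtain_pred[OF assms(1,2) \<open>l < x\<close>] .
  have "F \<inter> {u<..<v} = {}"
  proof (rule ccontr)
    assume "F \<inter> {u<..<v} \<noteq> {}"
    then obtain y where "y \<in> F" "u < y" "y < v" by auto
    then show False using u v assms(5) by (cases "y < x"; cases "y = x") auto
  qed
  then show thesis using u v that by blast
qed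

text \<open>Take a common point \<open>x\<close>. If \<open>u < u'\<close>, then
  \<open>u' < x < v\<close> puts the point \<open>u'\<close> of \<open>F\<close> inside the first
  gap; the other three inequalities fail in the same way.\<close>

lemma gap_unique:
  fixes F :: "real set"
  assumes "F \<inter> {u<..<v} = {}" "F \<inter> {u'<..<v'} = {}"
    and "u \<in> F" "v \<in> F" "u' \<in> F" "v' \<in> F"
    and "{u<..<v} \<inter> {u'<..<v'} \<noteq> {}"
  shows "u = u' \<and> v = v'"
proof -
  obtain x where x: "u < x" "x < v" "u' < x" "x < v'" using assms(7) unfolding disjoint_iff greaterThanLessThan_iff by blast
  have "\<not> u < u'" "\<not> u' < u" "\<not> v < v'" "\<not> v' < v"
    using assms(1-6) x by (meson disjoint_iff greaterThanLessThan_iff order.strict_trans)+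
  then show ?thesis by auto
qed

lemma partition_on_gaps:
  assumes "finite F" "l \<in> F" "r \<in> F" "F \<subseteq> {l..r}"
  shows "partition_on {l..r} (gaps F \<union> (\<lambda>x. {x}) ` F)"
proof (rule partition_onI)
  show "\<Union> (gaps F \<union> (\<lambda>x. {x}) ` F) = {l..r}"
  proof
    show "\<Union> (gaps F \<union> (\<lambda>x. {x}) ` F) \<subseteq> {l..r}"
      using assms(4) by (force elim!: gapsE)
    show "{l..r} \<subseteq> \<Union> (gaps F \<union> (\<lambda>x. {x}) ` F)"
    proof
      fix x assume x: "x \<in> {l..r}"
      show "x \<in> \<Union> (gaps F \<union> (\<lambda>x. {x}) ` F)"
      proof (cases "x \<in> F")
        case False
        obtain u v where "u \<in> F" "v \<in> F" "u < x" "x < v" "F \<inter> {u<..<v} = {}"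
          using obtain_gap[OF assms(1-3) x False] .
        then have "{u<..<v} \<in> gaps F" "x \<in> {u<..<v}" unfolding gaps_def by force+
        then show ?thesis by blast
      qed auto
    qed
  qed
next
  fix S T assume S: "S \<in> gaps F \<union> (\<lambda>x. {x}) ` F" and T: "T \<in> gaps F \<union> (\<lambda>x. {x}) ` F" and "S \<noteq> T"
  consider "S \<in> gaps F" "T \<in> gaps F" | "S \<in> gaps F" "T \<in> (\<lambda>x. {x}) ` F"
    | "S \<in> (\<lambda>x. {x}) ` F" "T \<in> gaps F" | "S \<in> (\<lambda>x. {x}) ` F" "T \<in> (\<lambda>x. {x}) ` F"
    using S T by blast
  then show "disjnt S T"
  proof cases
    case 1
    obtain u v where uv: "u \<in> F" "v \<in> F" "F \<inter> {u<..<v} = {}" "S = {u<..<v}"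
      using 1(1) by (rule gapsE)
    obtain u' v' where uv': "u' \<in> F" "v' \<in> F" "F \<inter> {u'<..<v'} = {}" "T = {u'<..<v'}"
      using 1(2) by (rule gapsE)
    show ?thesis
      using gap_unique[OF uv(3) uv'(3) uv(1,2) uv'(1,2)] \<open>S \<noteq> T\<close>
      unfolding disjnt_def uv(4) uv'(4) by blast
  next
    case 2
    then show ?thesis unfolding disjnt_def by (blast elim!: gapsE)
  next
    case 3
    then show ?thesis unfolding disjnt_def by (blast elim!: gapsE)
  next
    case 4
    then show ?thesis using \<open>S \<noteq> T\<close> by auto
  qed
next
  have "S \<noteq> {}" if "S \<in> gaps F" for S using that by (auto elim!: gapsE)
  then show "{} \<notin> gaps F \<union> (\<lambda>x. {x}) ` F" by blast
qed

text \<open>Sending a gap to its left endpoint is a bijection onto all of \<open>F\<close> except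
  its maximum.\<close>

lemma card_gaps:
  assumes "finite F" "F \<noteq> {}"
  shows "card (gaps F) = card F - 1"
proof -
  have "bij_betw Inf (gaps F) (F - {Max F})"
    unfolding bij_betw_def
  proof
    show "inj_on Inf (gaps F)"
    proof (rule inj_onI)
      fix S T assume "S \<in> gaps F" "T \<in> gaps F" and eq: "Inf S = Inf T"
      then obtain u v u' v'
        where S: "u \<in> F" "v \<in> F" "u < v" "F \<inter> {u<..<v} = {}" "S = {u<..<v}"
        and T: "u' \<in> F" "v' \<in> F" "u' < v'" "F \<inter> {u'<..<v'} = {}" "T = {u'<..<v'}"
        by (metis gapsE)
      have "u = u'" using eq S(3,5) T(3,5) by simp
      \<comment> \<open>Gaps with the same left endpoint overlap just to the right of it, hence
        coincide.\<close>
      then have "{u<..<v} \<inter> {u'<..<v'} \<noteq> {}"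
        using S(3) T(3) dense[of u "min v v'"] by auto
      then show "S = T" using gap_unique[OF S(4) T(4) S(1,2) T(1,2)] S(5) T(5) by simp
    qed
    show "Inf ` gaps F = F - {Max F}"
    proof
      show "Inf ` gaps F \<subseteq> F - {Max F}"
      proof
        fix x assume "x \<in> Inf ` gaps F"
        then obtain u v where "u \<in> F" "v \<in> F" "u < v" "x = Inf {u<..<v}"
          by (auto elim!: gapsE)
        then show "x \<in> F - {Max F}" using Max_ge[OF assms(1), of v] by auto
      qed
      show "F - {Max F} \<subseteq> Inf ` gaps F"
      proof
        fix u assume u: "u \<in> F - {Max F}"
        then have "u < Max F" using Max_ge[OF assms(1), of u] by auto
        then obtain v where v: "v \<in> F" "u < v" "F \<inter> {u<..<v} = {}"
          using obtain_succ[OF assms(1) Max_in[OF assms]] by metis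
        then have "{u<..<v} \<in> gaps F" using u unfolding gaps_def by blast
        moreover have "Inf {u<..<v} = u" using v by simp
        ultimately show "u \<in> Inf ` gaps F" by (metis imageI)
      qed
    qed
  qed
  then show ?thesis
    using bij_betw_same_card[of Inf] Max_in[OF assms] by (metis card_Diff_singleton)
qed

text \<open>A connected set that misses \<open>F\<close> cannot pass an endpoint of the gap it
  starts in. One that meets \<open>F\<close> and has a second point contains an interval, hence a
  point off the finite set \<open>F\<close>, where \<open>W\<close> takes another value. The role of
  \<open>W\<close> will be played by the critical word.\<close>

lemma connected_constant_subset_cell:
  fixes W :: "real \<Rightarrow> 'b"
  assumes F: "finite F" "l \<in> F" "r \<in> F"
    and sep: "\<And>x y. x \<in> F \<Longrightarrow> y \<in> {l..r} - F \<Longrightarrow> W x \<noteq> W y"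
    and T: "T \<noteq> {}" "T \<subseteq> {l..r}" "connected T" "W constant_on T"
  shows "\<exists>S \<in> gaps F \<union> (\<lambda>x. {x}) ` F. T \<subseteq> S"
proof (cases "T \<inter> F = {}")
  case True
  obtain t where t: "t \<in> T" using T by auto
  then obtain u v where uv: "u \<in> F" "v \<in> F" "u < t" "t < v" "F \<inter> {u<..<v} = {}"
    using obtain_gap[OF F, of t] T(2) True by blast
  have "T \<subseteq> {u<..<v}"
  proof
    fix y assume y: "y \<in> T"
    have "u \<notin> T" "v \<notin> T" using True uv by auto
    then show "y \<in> {u<..<v}"
      using T(3) t y uv(3,4) unfolding connected_iff_interval
      by (metis greaterThanLessThan_iff less_eq_real_def not_le_imp_less)
  qed
  moreover have "{u<..<v} \<in> gaps F" using uv unfolding gaps_def by force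
  ultimately show ?thesis by blast
next
  case False
  then obtain x where x: "x \<in> T" "x \<in> F" by auto
  have "y = x" if y: "y \<in> T" for y
  proof (rule ccontr)
    assume "y \<noteq> x"
    then have "infinite {min x y<..<max x y}" by (auto simp: min_def max_def)
    then obtain z where z: "z \<in> {min x y<..<max x y}" "z \<notin> F"
      using F(1) by (meson finite_subset subsetI)
    then have "z \<in> T"
      using T(3) x(1) y unfolding connected_iff_interval
      by (metis greaterThanLessThan_iff less_eq_real_def max_def min_def)
    then show False
      using sep[OF x(2), of z] z(2) T(2,4) x(1) unfolding constant_on_def by auto
  qed
  then show ?thesis using x by blast
qed

section \<open>Farey numbers\<close>

text \<open>Reducing a fraction only lowers its denominator, so any denominator up to
  \<open>n\<close> will do. In this form membership is a statement about integer multiples of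
  \<open>x\<close>, which is how orbits of the rotation meet it.\<close>

lemma farey_iff:
  "x \<in> farey n \<longleftrightarrow> 0 \<le> x \<and> x \<le> 1 \<and> (\<exists>q\<in>{1..n}. real q * x \<in> \<int>)"
proof
  assume "x \<in> farey n"
  then obtain p q where "x = real p / real q" "1 \<le> q" "q \<le> n" "p \<le> q"
    unfolding farey_def by auto
  then show "0 \<le> x \<and> x \<le> 1 \<and> (\<exists>q\<in>{1..n}. real q * x \<in> \<int>)"
    by (auto intro!: bexI[of _ q])
next
  assume R: "0 \<le> x \<and> x \<le> 1 \<and> (\<exists>q\<in>{1..n}. real q * x \<in> \<int>)"
  then obtain q where q: "1 \<le> q" "q \<le> n" "real q * x \<in> \<int>" by auto
  obtain m where m: "real q * x = of_int m" using q(3) by (auto elim: Ints_cases)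
  have "m \<ge> 0" using m R by (metis mult_nonneg_nonneg of_int_0_le_iff of_nat_0_le_iff)
  define p where "p = nat m"
  have p: "real q * x = real p" using m \<open>m \<ge> 0\<close> by (simp add: p_def)
  have "real p \<le> real q" using p R by (metis mult_left_le of_nat_0_le_iff)
  then have pq: "p \<le> q" by simp
  let ?g = "gcd p q"
  have g: "?g > 0" using q by simp
  have eq: "x = real (p div ?g) / real (q div ?g)"
    using p q g by (simp add: real_of_nat_div field_simps)
  have "coprime (p div ?g) (q div ?g)" using g by (intro div_gcd_coprime) auto
  moreover have "1 \<le> q div ?g" using q g by (simp add: div_greater_zero_iff Suc_leI dvd_imp_le)
  moreover have "q div ?g \<le> n" using q(2) by (meson div_le_dividend order_trans)
  moreover have "p div ?g \<le> q div ?g" using pq by (rule div_le_mono)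
  ultimately show "x \<in> farey n" using eq unfolding farey_def by blast
qed

lemma finite_farey: "finite (farey n)"
proof (rule finite_subset)
  show "farey n \<subseteq> (\<lambda>(p,q). real p / real q) ` ({..n} \<times> {..n})"
    unfolding farey_def by force
qed auto

text \<open>As \<open>p\<close> is invertible modulo \<open>q\<close>, only multiples of
  \<open>q\<close> clear the denominator. The factor is an integer rather than a natural number
  because it will be a difference of two times.\<close>

lemma mult_fraction_in_Ints_iff:
  fixes m :: int
  assumes "q \<ge> 1" "coprime p q"
  shows "of_int m * (real p / real q) \<in> \<int> \<longleftrightarrow> int q dvd m"
proof
  assume "of_int m * (real p / real q) \<in> \<int>"
  then obtain c where "of_int m * (real p / real q) = of_int c" by (auto elim: Ints_cases)
  then have "of_int m * real p = of_int c * real q" using assms(1) by (simp add: field_simps)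
  then have "real_of_int (m * int p) = real_of_int (c * int q)" by simp
  then have "m * int p = c * int q" by (simp only: of_int_eq_iff)
  then have "int q dvd m * int p" by simp
  moreover have "coprime (int q) (int p)" using assms(2) by (simp add: coprime_commute)
  ultimately show "int q dvd m" by (metis coprime_dvd_mult_left_iff)
next
  assume "int q dvd m"
  then obtain c where "m = int q * c" by auto
  then have "of_int m * (real p / real q) = of_int (c * int p)" using assms(1) by simp
  then show "of_int m * (real p / real q) \<in> \<int>" by (metis Ints_of_int)
qed

section \<open>Orbits of a rotation\<close>

lemma frac_eq_frac_iff:
  fixes x y :: real
  shows "frac x = frac y \<longleftrightarrow> x - y \<in> \<int>"
proof
  assume "frac x = frac y"
  then have "x - y = of_int (\<lfloor>x\<rfloor> - \<lfloor>y\<rfloor>)" by (simp add: frac_def)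
  then show "x - y \<in> \<int>" by (metis Ints_of_int)
next
  assume "x - y \<in> \<int>"
  then obtain c where "x = y + of_int c" by (metis Ints_cases add.commute diff_add_cancel)
  then show "frac x = frac y" by (simp add: frac_def)
qed

lemma rotation_funpow:
  assumes "0 \<le> x" "x < 1"
  shows "(rotation \<theta> ^^ k) x = frac (x + real k * \<theta>)"
proof (induction k)
  case 0
  then show ?case using assms by (simp add: frac_eq)
next
  case (Suc k)
  have "frac (frac (x + real k * \<theta>) + \<theta>) = frac (x + real (Suc k) * \<theta>)"
    unfolding frac_add_simps by (simp add: algebra_simps)
  then show ?case using Suc by (simp add: rotation_def)
qed

lemma orbit_word_0:
  "orbit_word \<theta> \<rho> 0 m = map (\<lambda>k. if frac (real k * \<theta>) < \<rho> then La else Lb) [0..<m]"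
  unfolding orbit_word_def symbol_def by (simp add: rotation_funpow)

text \<open>Shifting phase space by \<open>-\<rho>\<close> turns the orbit of the boundary point \<open>\<rho>\<close> into the orbit
  of \<open>0\<close>, and \<open>[\<rho>,1)\<close> into \<open>[0,1-\<rho>)\<close>; this reduces negative chains to positive ones with the
  letters exchanged.\<close>
lemma orbit_word_frac:
  assumes "0 \<le> \<rho>" "\<rho> \<le> 1"
  shows "orbit_word \<theta> \<rho> (frac \<rho>) m =
    map (\<lambda>k. if frac (real k * \<theta>) < 1 - \<rho> then Lb else La) [0..<m]"
proof -
  have "symbol \<rho> ((rotation \<theta> ^^ k) (frac \<rho>)) =
      (if frac (real k * \<theta>) < 1 - \<rho> then Lb else La)" for k
  proof -
    let ?f = "frac (real k * \<theta>)"
    have f: "0 \<le> ?f" "?f < 1" by (simp_all add: frac_lt_1)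
    have "(rotation \<theta> ^^ k) (frac \<rho>) = frac (\<rho> + real k * \<theta>)"
      by (simp add: rotation_funpow frac_lt_1 frac_add_simps)
    also have "\<dots> = frac (?f + \<rho>)"
      by (simp add: frac_add_simps add.commute)
    \<comment> \<open>The sum lies in \<open>[0,2)\<close>, so at most one wrap past 1
      occurs.\<close>
    also have "\<dots> = (if ?f < 1 - \<rho> then ?f + \<rho> else ?f + \<rho> - 1)"
    proof (cases "?f < 1 - \<rho>")
      case True
      then have "frac (?f + \<rho>) = ?f + \<rho>" using f assms by (subst frac_eq) auto
      then show ?thesis using True by simp
    next
      case False
      have "frac (?f + \<rho>) = frac (?f + \<rho> - 1)" unfolding frac_eq_frac_iff by simp
      also have "\<dots> = ?f + \<rho> - 1" using False f assms by (subst frac_eq) auto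
      finally show ?thesis using False by simp
    qed
    finally have "(rotation \<theta> ^^ k) (frac \<rho>) =
      (if ?f < 1 - \<rho> then ?f + \<rho> else ?f + \<rho> - 1)" .
    \<comment> \<open>Unwrapped points lie at or above \<rho>; wrapped points lie below it because
      \<open>y < 1\<close>.\<close>
    moreover have "symbol \<rho> (if y < 1 - \<rho> then y + \<rho> else y + \<rho> - 1) =
        (if y < 1 - \<rho> then Lb else La)" if "0 \<le> y" "y < 1" for y
      using that by (auto simp: symbol_def)
    ultimately show ?thesis using f by simp
  qed
  then show ?thesis unfolding orbit_word_def by simp
qed

section \<open>Words on a chain\<close>

locale nonzero_chain =
  fixes i j :: int
  assumes chain_index: "chain_index i j" and nonzero: "i \<noteq> 0"
begin

definition n :: nat where "n = nat \<bar>i\<bar>"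

text \<open>For \<open>i < 0\<close> the reflection of \<rho> to \<open>1 - \<rho>\<close> turns the
  chain into the positive one with slope \<open>n\<close> and this offset:
  \<open>n\<theta> - J = 1 - \<rho>\<close>.\<close>

definition J :: int where "J = (if i > 0 then j else - j - 1)"

definition a :: letter where "a = (if i > 0 then La else Lb)"

definition b :: letter where "b = (if i > 0 then Lb else La)"

definition l :: real where "l = theta_minus i j"

definition r :: real where "r = theta_plus i j"

definition F :: "real set" where "F = farey n \<inter> {l..r}"

definition pt :: "real \<Rightarrow> real \<times> real" where "pt \<theta> = (\<theta>, of_int i * \<theta> - of_int j)"

text \<open>The normalised word: the orbit of 0 is compared with the boundary
  \<open>n\<theta> - J\<close>, whatever the sign of \<open>i\<close>. The length is a parameter
  because critical words can be shorter than \<open>n\<close>.\<close>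

definition prefix :: "real \<Rightarrow> nat \<Rightarrow> letter list" where
  "prefix \<theta> m = map (\<lambda>k. if frac (real k * \<theta>) < real n * \<theta> - of_int J then a else b) [0..<m]"

abbreviation W :: "real \<Rightarrow> letter list" where "W \<theta> \<equiv> prefix \<theta> n"

lemma n_pos: "n > 0" using nonzero by (simp add: n_def)

lemma J_bounds: "0 \<le> J" "J < int n"
  using chain_index nonzero by (auto simp: chain_index_def J_def n_def)

lemma J_bounds_real: "0 \<le> real_of_int J" "real_of_int J + 1 \<le> real n"
  using J_bounds by linarith+

lemma l_eq: "l = of_int J / real n" and r_eq: "r = (of_int J + 1) / real n"
proof -
  show l: "l = of_int J / real n"
    using nonzero by (auto simp: l_def theta_minus_def J_def n_def field_simps)
  have "r = l + 1 / real n" using nonzero by (auto simp: r_def l_def theta_plus_def n_def)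
  then show "r = (of_int J + 1) / real n" unfolding l by (simp add: add_divide_distrib)
qed

lemma l_less_r: "l < r"
  using n_pos by (simp add: l_eq r_eq divide_strict_right_mono)

lemma interval_subset: "{l..r} \<subseteq> {0..1}"
  using n_pos J_bounds_real by (auto simp: l_eq r_eq field_simps intro: order_trans)

lemma in_interval_iff:
  "\<theta> \<in> {l..r} \<longleftrightarrow> 0 \<le> real n * \<theta> - of_int J \<and> real n * \<theta> - of_int J \<le> 1"
  using n_pos by (auto simp: l_eq r_eq field_simps)

lemma snd_pt: "of_int i * \<theta> - of_int j =
    (if i > 0 then real n * \<theta> - of_int J else 1 - (real n * \<theta> - of_int J))"
  using nonzero by (auto simp: J_def n_def)

text \<open>The constraint on \<rho> alone confines \<theta> to \<open>[l,r]\<close>, which lies in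
  \<open>[0,1]\<close>. The chain is thus a graph over an interval, and its subsets can be studied
  through \<theta>.\<close>

lemma chain_eq: "chain i j = pt ` {l..r}"
proof -
  have "(\<theta>, of_int i * \<theta> - of_int j) \<in> chain i j \<longleftrightarrow> \<theta> \<in> {l..r}" for \<theta>
  proof -
    have "(\<theta>, of_int i * \<theta> - of_int j) \<in> chain i j \<longleftrightarrow> \<theta> \<in> {0..1} \<and> \<theta> \<in> {l..r}"
      unfolding chain_def in_interval_iff snd_pt by auto
    then show ?thesis using interval_subset by blast
  qed
  then show ?thesis unfolding pt_def by (force simp: chain_def)
qed

lemma fst_pt [simp]: "fst (pt \<theta>) = \<theta>" by (simp add: pt_def)

lemma pt_eq_iff [simp]: "pt x = pt y \<longleftrightarrow> x = y" by (auto simp: pt_def)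

lemma fst_image_pt [simp]: "fst ` pt ` S = S" by (simp add: image_image)

lemma pt_fst:
  assumes "P \<in> chain i j"
  shows "pt (fst P) = P" "fst P \<in> {l..r}"
  using assms unfolding chain_eq by auto

lemma pt_fst_image: "S \<subseteq> chain i j \<Longrightarrow> pt ` fst ` S = S"
proof -
  assume "S \<subseteq> chain i j"
  then have "pt (fst P) = id P" if "P \<in> S" for P using that pt_fst(1)[of P] by auto
  then have "(\<lambda>P. pt (fst P)) ` S = id ` S" by (intro image_cong refl)
  then show ?thesis by (simp add: image_image)
qed

lemma continuous_on_pt: "continuous_on S pt"
  unfolding pt_def by (intro continuous_intros)

text \<open>\<open>pt\<close> is affine and so preserves convex combinations.\<close>

lemma open_segment_pt: "u < v \<Longrightarrow> open_segment (pt u) (pt v) = pt ` {u<..<v}"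
proof -
  assume "u < v"
  then have "{u<..<v} = open_segment u v" by (simp add: open_segment_eq_real_ivl)
  also have "pt ` \<dots> = open_segment (pt u) (pt v)"
    using \<open>u < v\<close> by (simp add: open_segment_image_interval image_image)
      (auto intro!: image_cong simp: pt_def algebra_simps)
  finally show ?thesis by simp
qed

section \<open>Boundary and critical words in normalised form\<close>

lemma boundary_word_pt:
  assumes "\<theta> \<in> {l..r}"
  shows "boundary_word i (pt \<theta>) = W \<theta>"
proof (cases "i > 0")
  case True
  then show ?thesis
    by (simp add: boundary_word_def pt_def orbit_word_0 prefix_def snd_pt)
      (simp add: n_def a_def b_def)
next
  case False
  have "0 \<le> of_int i * \<theta> - of_int j" "of_int i * \<theta> - of_int j \<le> 1"
    using assms False unfolding in_interval_iff snd_pt by auto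
  then have "boundary_word i (pt \<theta>) = map (\<lambda>k. if frac (real k * \<theta>) <
      1 - (of_int i * \<theta> - of_int j) then Lb else La) [0..<n]"
    using False by (simp add: boundary_word_def pt_def orbit_word_frac n_def)
  then show ?thesis using False by (simp add: prefix_def snd_pt a_def b_def)
qed

text \<open>Modulo 1, \<rho> equals \<open>n\<theta>\<close> on a positive chain and
  \<open>-n\<theta>\<close> on a negative one, so in both cases the target is hit at time
  \<open>m\<close> exactly when \<open>(n - m)\<theta>\<close> is an integer. The endpoints are set
  apart because \<rho> is 0 or 1 there and the critical word is empty by convention.\<close>

lemma critical_word_pt:
  assumes "\<theta> \<in> {l..r}" "\<theta> \<noteq> l" "\<theta> \<noteq> r"
  shows "critical_word i (pt \<theta>) = prefix \<theta> (LEAST m. (real n - real m) * \<theta> \<in> \<int>)"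
proof -
  define \<rho> where "\<rho> = of_int i * \<theta> - of_int j"
  have \<rho>: "\<rho> = (if i > 0 then real n * \<theta> - of_int J else 1 - (real n * \<theta> - of_int J))"
    unfolding \<rho>_def by (rule snd_pt)
  have "l < \<theta>" "\<theta> < r" using assms by auto
  then have bounds: "0 < \<rho>" "\<rho> < 1"
    using n_pos unfolding \<rho> l_eq r_eq by (auto simp: field_simps)
  have frac_\<rho>: "frac \<rho> = \<rho>" using bounds by (simp add: frac_eq)
  show ?thesis
  proof (cases "i > 0")
    case True
    have hit: "(rotation \<theta> ^^ m) 0 = \<rho> \<longleftrightarrow> (real n - real m) * \<theta> \<in> \<int>" for m
    proof -
      have "(rotation \<theta> ^^ m) 0 = \<rho> \<longleftrightarrow> frac \<rho> = frac (real m * \<theta>)"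
        using frac_\<rho> by (auto simp: rotation_funpow)
      also have "\<dots> \<longleftrightarrow> (real n - real m) * \<theta> - of_int J \<in> \<int>"
        unfolding frac_eq_frac_iff \<rho> using True by (simp add: algebra_simps)
      finally show ?thesis by simp
    qed
    have "critical_word i (pt \<theta>) = orbit_word \<theta> \<rho> 0 (LEAST m. (real n - real m) * \<theta> \<in> \<int>)"
      using bounds True unfolding critical_word_def pt_def \<rho>_def[symmetric] by (simp add: hit)
    then show ?thesis
      using True by (simp add: orbit_word_0 prefix_def a_def b_def \<rho>)
  next
    case False
    have hit: "(rotation \<theta> ^^ m) \<rho> = 0 \<longleftrightarrow> (real n - real m) * \<theta> \<in> \<int>" for m
    proof -
      have "(rotation \<theta> ^^ m) \<rho> = 0 \<longleftrightarrow> \<rho> + real m * \<theta> \<in> \<int>"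
        using bounds by (simp add: rotation_funpow)
      also have "\<rho> + real m * \<theta> = of_int (1 + J) - (real n - real m) * \<theta>"
        using False unfolding \<rho> by (simp add: algebra_simps)
      also have "\<dots> \<in> \<int> \<longleftrightarrow> (real n - real m) * \<theta> \<in> \<int>"
        by (metis Ints_diff Ints_of_int diff_diff_eq2 add_diff_cancel_left')
      finally show ?thesis .
    qed
    have "critical_word i (pt \<theta>) = orbit_word \<theta> \<rho> (frac \<rho>) (LEAST m. (real n - real m) * \<theta> \<in> \<int>)"
      using bounds False unfolding critical_word_def pt_def \<rho>_def[symmetric] frac_\<rho> by (simp add: hit)
    also have "\<dots> = map (\<lambda>k. if frac (real k * \<theta>) < 1 - \<rho> then Lb else La)
        [0..<(LEAST m. (real n - real m) * \<theta> \<in> \<int>)]"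
      using bounds by (intro orbit_word_frac) auto
    finally show ?thesis using False by (simp add: prefix_def \<rho> a_def b_def)
  qed
qed

section \<open>The length of the critical word on and off the Farey set\<close>

lemma in_F_iff: "\<theta> \<in> F \<longleftrightarrow> \<theta> \<in> {l..r} \<and> (\<exists>q\<in>{1..n}. real q * \<theta> \<in> \<int>)"
  using interval_subset unfolding F_def by (auto simp: farey_iff)

lemma finite_F: "finite F" by (simp add: F_def finite_farey)

lemma F_subset: "F \<subseteq> {l..r}" by (simp add: F_def)

lemma l_in_F: "l \<in> F" and r_in_F: "r \<in> F"
proof -
  have "real n * l = of_int J" "real n * r = of_int (J + 1)"
    using n_pos by (simp_all add: l_eq r_eq)
  then have "real n * l \<in> \<int>" "real n * r \<in> \<int>" by (metis Ints_of_int)+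
  then show "l \<in> F" "r \<in> F" using n_pos l_less_r unfolding in_F_iff by force+
qed

lemma length_prefix [simp]: "length (prefix \<theta> m) = m" by (simp add: prefix_def)

text \<open>A hit at a time \<open>m < n\<close> would make \<open>n - m\<close> a denominator of
  \<theta>. Off \<open>F\<close> the first hit is therefore at time \<open>n\<close>, and the
  critical word is the full boundary word.\<close>

lemma critical_word_outside_F:
  assumes "\<theta> \<in> {l..r} - F"
  shows "critical_word i (pt \<theta>) = W \<theta>"
proof -
  have "(LEAST m. (real n - real m) * \<theta> \<in> \<int>) = n"
  proof (rule Least_equality)
    fix m assume m: "(real n - real m) * \<theta> \<in> \<int>"
    show "n \<le> m"
    proof (rule ccontr)
      assume "\<not> n \<le> m"
      then have "n - m \<in> {1..n}" "real (n - m) * \<theta> \<in> \<int>" using m by (auto simp: of_nat_diff)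
      then have "\<theta> \<in> F" using assms in_F_iff by blast
      then show False using assms by blast
    qed
  qed simp
  then show ?thesis using assms l_in_F r_in_F by (subst critical_word_pt) auto
qed

text \<open>A denominator \<open>q\<close> of \<theta> produces a hit already at time
  \<open>n - q\<close>; at the endpoints of the chain the word is empty.\<close>

lemma length_critical_word_F:
  assumes "\<theta> \<in> F"
  shows "length (critical_word i (pt \<theta>)) < n"
proof (cases "\<theta> = l \<or> \<theta> = r")
  case True
  then have "of_int i * \<theta> - of_int j = 0 \<or> of_int i * \<theta> - of_int j = 1"
    using n_pos unfolding snd_pt by (auto simp: l_eq r_eq)
  then show ?thesis using n_pos by (auto simp: critical_word_def pt_def)
next
  case False
  obtain q where q: "q \<in> {1..n}" "real q * \<theta> \<in> \<int>" using assms unfolding in_F_iff by auto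
  then have "(real n - real (n - q)) * \<theta> \<in> \<int>" by (simp add: of_nat_diff)
  then have "(LEAST m. (real n - real m) * \<theta> \<in> \<int>) \<le> n - q" by (rule Least_le)
  also have "\<dots> < n" using q n_pos by auto
  finally show ?thesis using assms False F_subset by (subst critical_word_pt) auto
qed

text \<open>The lengths already differ. This is the separation that isolates the Farey
  points.\<close>

lemma critical_word_F_neq:
  assumes "x \<in> F" "y \<in> {l..r} - F"
  shows "critical_word i (pt x) \<noteq> critical_word i (pt y)"
  using length_critical_word_F[OF assms(1)] critical_word_outside_F[OF assms(2)] by auto

text \<open>The letter at position \<open>k\<close> can only change where \<open>k\<theta>\<close> or \<open>(n - k)\<theta>\<close> passes an integer.\<close>
lemma W_constant_on_gap:
  assumes "u \<in> F" "v \<in> F" "F \<inter> {u<..<v} = {}" "u < x" "x < y" "y < v"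
  shows "W x = W y"
proof -
  have no_int: "real q * z \<notin> \<int>" if "q \<in> {1..n}" "x \<le> z" "z \<le> y" for q z
  proof
    assume "real q * z \<in> \<int>"
    moreover have "z \<in> {l..r}" using that assms F_subset by fastforce
    ultimately have "z \<in> F" using that(1) unfolding in_F_iff by blast
    then show False using assms that by force
  qed
  have crossing: "real q * x \<le> of_int c \<longleftrightarrow> real q * y \<le> of_int c" if "q \<in> {1..n}" for q c
  proof -
    have q: "real q > 0" using that by simp
    \<comment> \<open>If \<open>q z\<close> reached the integer \<open>c\<close> as \<open>z\<close>
      runs from \<open>x\<close> to \<open>y\<close>, it would do so at \<open>c / q\<close>, which
      \<open>no_int\<close> forbids.\<close>
    have "\<not> (x \<le> of_int c / real q \<and> of_int c / real q \<le> y)"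
      using no_int[OF that, of "of_int c / real q"] q by auto
    then have "\<not> (real q * x \<le> of_int c \<and> of_int c \<le> real q * y)"
      using q by (simp add: field_simps)
    moreover have "real q * x < real q * y" using q assms by simp
    ultimately show ?thesis by linarith
  qed
  have "frac (real k * x) < real n * x - of_int J \<longleftrightarrow> frac (real k * y) < real n * y - of_int J"
    if "k < n" for k
  proof -
    have floor: "\<lfloor>real k * x\<rfloor> = \<lfloor>real k * y\<rfloor>"
    proof (cases "k = 0")
      case False
      then have k: "k \<in> {1..n}" using that by auto
      have "\<lfloor>real k * x\<rfloor> \<le> \<lfloor>real k * y\<rfloor>" using assms by (intro floor_mono mult_left_mono) auto
      \<comment> \<open>If \<open>k x\<close> were at most the floor of \<open>k y\<close>, then by
        \<open>crossing\<close> so would be \<open>k y\<close>, which would then be an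
        integer.\<close>
      moreover have "real k * x \<le> of_int \<lfloor>real k * y\<rfloor> \<Longrightarrow> False"
        using crossing[OF k, of "\<lfloor>real k * y\<rfloor>"] no_int[OF k, of y] assms
        by (metis Ints_of_int floor_correct less_eq_real_def nle_le order.strict_trans2 order_refl)
      then have "of_int \<lfloor>real k * y\<rfloor> < real k * x" by fastforce
      ultimately show ?thesis by linarith
    qed simp
    \<comment> \<open>With the floor fixed, the letter condition at \<open>z\<close> says that
      \<open>(n - k) z\<close> exceeds the integer \<open>J\<close> minus that floor, so
      \<open>crossing\<close> applies to the multiplier \<open>n - k\<close>.\<close>
    have "n - k \<in> {1..n}" using that by auto
    from crossing[OF this, of "J - \<lfloor>real k * y\<rfloor>"] show ?thesis
      using that unfolding frac_def floor by (simp add: of_nat_diff algebra_simps) linarith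
  qed
  then show ?thesis by (simp add: prefix_def)
qed

section \<open>Critical curves and Farey points\<close>

lemma critical_word_gap:
  assumes "u \<in> F" "v \<in> F" "F \<inter> {u<..<v} = {}" "x \<in> {u<..<v}"
  shows "critical_word i (pt x) = W x"
proof (rule critical_word_outside_F)
  have "u \<in> {l..r}" "v \<in> {l..r}" using assms(1,2) F_subset by blast+
  then show "x \<in> {l..r} - F" using assms(3,4) by auto
qed

text \<open>The candidates for the maximal sets; \<open>critical_piece_iff\<close> confirms
  them.\<close>

definition pieces :: "(real \<times> real) set set" where
  "pieces = image pt ` (gaps F \<union> (\<lambda>x. {x}) ` F)"

lemma pieces_eq: "pieces = image pt ` gaps F \<union> (\<lambda>x. {pt x}) ` F"
  unfolding pieces_def by (simp add: image_Un image_image)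

lemma partition_on_pieces: "partition_on (chain i j) pieces"
proof -
  have "inj_on pt {l..r}" by (auto intro: inj_onI)
  from partition_on_inj_image[OF partition_on_gaps[OF finite_F l_in_F r_in_F F_subset] this]
  have "partition_on (chain i j) (pieces - {{}})" by (simp add: chain_eq pieces_def)
  moreover have "{} \<notin> pieces"
    unfolding pieces_def
    using partition_onD3[OF partition_on_gaps[OF finite_F l_in_F r_in_F F_subset]] by auto
  ultimately show ?thesis by simp
qed

text \<open>Candidates satisfy every requirement except, so far, maximality. On a gap the critical
  word is the full boundary word, which does not change there.\<close>

lemma piece_valid:
  assumes "S \<in> pieces"
  shows "S \<noteq> {}" "S \<subseteq> chain i j" "connected S" "critical_word i constant_on S"
proof -
  show "S \<noteq> {}" "S \<subseteq> chain i j"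
    using assms partition_onD3[OF partition_on_pieces] partition_onD1[OF partition_on_pieces]
    by blast+
  obtain T where T: "T \<in> gaps F \<union> (\<lambda>x. {x}) ` F" "S = pt ` T"
    using assms unfolding pieces_def by blast
  have "connected T" using T(1) by (auto elim!: gapsE)
  then show "connected S" unfolding T(2) by (intro connected_continuous_image continuous_on_pt)
  show "critical_word i constant_on S"
  proof (cases "T \<in> gaps F")
    case True
    then obtain u v where uv: "u \<in> F" "v \<in> F" "u < v" "F \<inter> {u<..<v} = {}" "T = {u<..<v}"
      by (rule gapsE)
    have "critical_word i (pt x) = critical_word i (pt y)" if "x \<in> T" "y \<in> T" for x y
      using that critical_word_gap[OF uv(1,2,4)] W_constant_on_gap[OF uv(1,2,4)] uv(5)
      by (cases x y rule: linorder_cases) auto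
    then show ?thesis unfolding T(2) constant_on_def by blast
  next
    case False
    then show ?thesis using T by (auto simp: constant_on_def)
  qed
qed

text \<open>Projection to \<theta> keeps connectedness and moves the question to
  \<open>[l,r]\<close>, where critical words on \<open>F\<close> differ from those off
  \<open>F\<close>.\<close>

lemma valid_subset_piece:
  assumes "S \<noteq> {}" "S \<subseteq> chain i j" "connected S" "critical_word i constant_on S"
  shows "\<exists>T\<in>pieces. S \<subseteq> T"
proof -
  have S: "S = pt ` fst ` S" using pt_fst_image[OF assms(2)] by simp
  have "\<exists>T \<in> gaps F \<union> (\<lambda>x. {x}) ` F. fst ` S \<subseteq> T"
  proof (rule connected_constant_subset_cell[OF finite_F l_in_F r_in_F])
    show "critical_word i (pt x) \<noteq> critical_word i (pt y)" if "x \<in> F" "y \<in> {l..r} - F" for x y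
      using critical_word_F_neq[OF that] .
    show "fst ` S \<subseteq> {l..r}" using assms(2) pt_fst(2) by blast
    show "connected (fst ` S)" by (intro connected_continuous_image assms continuous_intros)
    have "pt (fst P) = P" if "P \<in> S" for P using that assms(2) pt_fst(1) by blast
    then show "(\<lambda>x. critical_word i (pt x)) constant_on fst ` S"
      using assms(4) unfolding constant_on_def by auto
  qed (use assms in auto)
  then obtain T where T: "T \<in> gaps F \<union> (\<lambda>x. {x}) ` F" "fst ` S \<subseteq> T" by blast
  have "pt ` T \<in> pieces" unfolding pieces_def using T(1) by (rule imageI)
  moreover have "S \<subseteq> pt ` T" by (subst S) (rule image_mono[OF T(2)])
  ultimately show ?thesis by blast
qed

text \<open>Every admissible set lies in a candidate and candidates are admissible, so a maximal set
  equals the candidate around it. Conversely, an admissible set containing a candidate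
  \<open>S\<close> lies in some candidate, which is \<open>S\<close> itself since distinct
  candidates are disjoint.\<close>

lemma critical_piece_iff: "critical_piece i j S \<longleftrightarrow> S \<in> pieces"
proof
  assume "critical_piece i j S"
  then have S: "S \<noteq> {}" "S \<subseteq> chain i j" "connected S" "critical_word i constant_on S"
    and max: "\<And>T. S \<subseteq> T \<Longrightarrow> T \<subseteq> chain i j \<Longrightarrow> connected T \<Longrightarrow> critical_word i constant_on T \<Longrightarrow> T = S"
    unfolding critical_piece_def by blast+
  then obtain T where T: "T \<in> pieces" "S \<subseteq> T"
    using valid_subset_piece[OF S] by blast
  have "T = S" using max[OF T(2) piece_valid(2-4)[OF T(1)]] .
  then show "S \<in> pieces" using T(1) by simp
next
  assume S: "S \<in> pieces"
  have "T = S" if T: "S \<subseteq> T" "T \<subseteq> chain i j" "connected T" "critical_word i constant_on T" for T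
  proof -
    have "T \<noteq> {}" using piece_valid(1)[OF S] T(1) by blast
    then obtain U where U: "U \<in> pieces" "T \<subseteq> U" using valid_subset_piece[OF _ T(2-4)] by blast
    have "U = S"
    proof (rule ccontr)
      assume "U \<noteq> S"
      then have "disjnt U S"
        using partition_onD2[OF partition_on_pieces] U(1) S unfolding pairwise_def by blast
      then show False using piece_valid(1)[OF S] T(1) U(2) by (auto simp: disjnt_def)
    qed
    then show "T = S" using T U by auto
  qed
  then show "critical_piece i j S"
    using piece_valid[OF S] unfolding critical_piece_def by blast
qed

lemma critical_curve_iff: "critical_curve i j C \<longleftrightarrow> C \<in> image pt ` gaps F"
proof
  assume "critical_curve i j C"
  then have "C \<in> pieces" "\<And>P. C \<noteq> {P}" unfolding critical_curve_def critical_piece_iff by blast+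
  then show "C \<in> image pt ` gaps F" unfolding pieces_eq by blast
next
  assume C: "C \<in> image pt ` gaps F"
  then obtain u v where uv: "u < v" "C = pt ` {u<..<v}" by (auto elim!: gapsE)
  obtain x where x: "u < x" "x < v" using dense uv(1) by blast
  obtain y where "x < y" "y < v" using dense x(2) by blast
  then have "pt x \<in> C" "pt y \<in> C" "pt x \<noteq> pt y" using x uv by auto
  moreover have "C \<in> pieces" using C unfolding pieces_eq by blast
  ultimately show "critical_curve i j C" unfolding critical_curve_def critical_piece_iff by blast
qed

lemma farey_point_iff: "farey_point i j P \<longleftrightarrow> P \<in> pt ` F"
proof
  assume "farey_point i j P"
  then have "{P} \<in> pieces" unfolding farey_point_def critical_piece_iff .
  moreover have "{P} \<notin> image pt ` gaps F"
    unfolding critical_curve_iff[symmetric] critical_curve_def by blast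
  ultimately show "P \<in> pt ` F" unfolding pieces_eq by auto
next
  assume "P \<in> pt ` F"
  then show "farey_point i j P" unfolding farey_point_def critical_piece_iff pieces_eq by blast
qed

lemma farey_points: "{P. farey_point i j P} = {P \<in> chain i j. fst P \<in> F}"
proof -
  have "P \<in> pt ` F \<longleftrightarrow> P \<in> chain i j \<and> fst P \<in> F" for P
  proof
    assume "P \<in> pt ` F"
    then show "P \<in> chain i j \<and> fst P \<in> F" using F_subset unfolding chain_eq by auto
  next
    assume "P \<in> chain i j \<and> fst P \<in> F"
    then show "P \<in> pt ` F" using pt_fst(1)[of P] by (metis imageI)
  qed
  then show ?thesis unfolding farey_point_iff by simp
qed

section \<open>Partition, count and shape of the critical curves and Farey points\<close>

lemma partition_on_chain:
  "partition_on (chain i j) ({C. critical_curve i j C} \<union> {{P} | P. farey_point i j P})"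
proof -
  have "{C. critical_curve i j C} \<union> {{P} | P. farey_point i j P} = pieces"
    unfolding critical_curve_iff farey_point_iff pieces_eq by blast
  then show ?thesis using partition_on_pieces by simp
qed

lemma card_farey_points: "card {P. farey_point i j P} = card F"
  unfolding farey_point_iff by (simp add: card_image inj_on_def)

lemma card_critical_curves: "card {C. critical_curve i j C} = card F - 1"
proof -
  have "inj pt" by (simp add: inj_on_def)
  then have "inj_on (image pt) (gaps F)" by (auto intro!: inj_onI simp: inj_image_eq_iff)
  then have "card (image pt ` gaps F) = card (gaps F)" by (rule card_image)
  also have "\<dots> = card F - 1" using card_gaps finite_F l_in_F by blast
  finally show ?thesis unfolding critical_curve_iff by simp
qed

lemma critical_curves:
  "{C. critical_curve i j C} =
     {open_segment P Q | P Q. P \<in> chain i j \<and> Q \<in> chain i j \<and> fst P \<in> F \<and> fst Q \<in> F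
        \<and> fst P < fst Q \<and> F \<inter> {fst P<..<fst Q} = {}}" (is "_ = ?R")
proof
  show "{C. critical_curve i j C} \<subseteq> ?R"
  proof
    fix C assume "C \<in> {C. critical_curve i j C}"
    then obtain u v where uv: "u \<in> F" "v \<in> F" "u < v" "F \<inter> {u<..<v} = {}" "C = pt ` {u<..<v}"
      unfolding critical_curve_iff by (auto elim!: gapsE)
    then have "C = open_segment (pt u) (pt v)" "pt u \<in> chain i j" "pt v \<in> chain i j"
      using F_subset by (auto simp: open_segment_pt chain_eq)
    then have "C = open_segment (pt u) (pt v) \<and> pt u \<in> chain i j \<and> pt v \<in> chain i j
        \<and> fst (pt u) \<in> F \<and> fst (pt v) \<in> F \<and> fst (pt u) < fst (pt v)
        \<and> F \<inter> {fst (pt u)<..<fst (pt v)} = {}" using uv(1-4) by simp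
    then show "C \<in> ?R" by blast
  qed
  show "?R \<subseteq> {C. critical_curve i j C}"
  proof
    fix C assume "C \<in> ?R"
    then obtain P Q where C: "C = open_segment P Q" "P \<in> chain i j" "Q \<in> chain i j"
      "fst P \<in> F" "fst Q \<in> F" "fst P < fst Q" "F \<inter> {fst P<..<fst Q} = {}" by blast
    then have "C = pt ` {fst P<..<fst Q}" using open_segment_pt[of "fst P" "fst Q"] pt_fst(1) by simp
    moreover have "{fst P<..<fst Q} \<in> gaps F" using C unfolding gaps_def by blast
    ultimately show "C \<in> {C. critical_curve i j C}" unfolding critical_curve_iff by blast
  qed
qed

section \<open>The words adjacent to a Farey point\<close>

text \<open>The curve is nonempty, which makes the common value unique; it can be read off at any
  point \<open>x\<close> of the gap, in particular close to an endpoint.\<close>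

lemma curve_word_gap:
  assumes "u \<in> F" "v \<in> F" "F \<inter> {u<..<v} = {}" "x \<in> {u<..<v}"
  shows "curve_word i (pt ` {u<..<v}) = W x"
  unfolding curve_word_def
proof (rule the_equality)
  have "critical_word i (pt y) = W x" if "y \<in> {u<..<v}" for y
    using that assms critical_word_gap[OF assms(1-3)] W_constant_on_gap[OF assms(1-3)]
    by (cases x y rule: linorder_cases) auto
  then show "\<forall>Q\<in>pt ` {u<..<v}. critical_word i Q = W x" by blast
  show "w = W x" if "\<forall>Q\<in>pt ` {u<..<v}. critical_word i Q = w" for w
    using that assms(4) critical_word_gap[OF assms] by auto
qed

text \<open>Closures are pushed through continuous maps: the projection in one direction,
  \<open>pt\<close> in the other.\<close>

lemma pt_in_closure_gap_iff:
  assumes "u < v"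
  shows "pt x \<in> closure (pt ` {u<..<v}) \<longleftrightarrow> x \<in> {u..v}"
proof
  assume "pt x \<in> closure (pt ` {u<..<v})"
  then have "fst (pt x) \<in> fst ` closure (pt ` {u<..<v})" by blast
  also have "\<dots> \<subseteq> closure (fst ` pt ` {u<..<v})"
    by (intro continuous_image_closure_subset[of UNIV] continuous_intros) auto
  finally show "x \<in> {u..v}" using assms by (simp del: fst_image_pt add: image_image)
next
  assume "x \<in> {u..v}"
  then have "pt x \<in> pt ` closure {u<..<v}" using assms by simp
  also have "\<dots> \<subseteq> closure (pt ` {u<..<v})"
    by (intro continuous_image_closure_subset[of UNIV] continuous_on_pt) auto
  finally show "pt x \<in> closure (pt ` {u<..<v})" .
qed

text \<open>A gap all of whose points exceed \<open>x\<close> has left endpoint at least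
  \<open>x\<close>; adherence of \<open>x\<close> to it forces equality.\<close>

lemma right_curve_pt_iff:
  assumes "x \<in> F"
  shows "right_curve i j (pt x) C \<longleftrightarrow>
    (\<exists>v\<in>F. x < v \<and> F \<inter> {x<..<v} = {} \<and> C = pt ` {x<..<v})"
proof
  assume R: "right_curve i j (pt x) C"
  then obtain u v where uv: "u \<in> F" "v \<in> F" "u < v" "F \<inter> {u<..<v} = {}" "C = pt ` {u<..<v}"
    unfolding right_curve_def critical_curve_iff by (auto elim!: gapsE)
  have "x \<in> {u..v}"
    using R uv(3,5) pt_in_closure_gap_iff unfolding right_curve_def by blast
  moreover have "\<forall>y\<in>{u<..<v}. x < y" using R uv(5) unfolding right_curve_def by auto
  then have "x \<le> u" using uv(3) by (meson dense_ge_bounded greaterThanLessThan_iff less_imp_le)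
  ultimately have "u = x" by simp
  then show "\<exists>v\<in>F. x < v \<and> F \<inter> {x<..<v} = {} \<and> C = pt ` {x<..<v}" using uv by blast
next
  assume "\<exists>v\<in>F. x < v \<and> F \<inter> {x<..<v} = {} \<and> C = pt ` {x<..<v}"
  then obtain v where v: "v \<in> F" "x < v" "F \<inter> {x<..<v} = {}" "C = pt ` {x<..<v}" by blast
  then have "{x<..<v} \<in> gaps F" using assms unfolding gaps_def by blast
  then show "right_curve i j (pt x) C"
    using v unfolding right_curve_def critical_curve_iff by (auto simp: pt_in_closure_gap_iff)
qed

lemma left_curve_pt_iff:
  assumes "x \<in> F"
  shows "left_curve i j (pt x) C \<longleftrightarrow>
    (\<exists>u\<in>F. u < x \<and> F \<inter> {u<..<x} = {} \<and> C = pt ` {u<..<x})"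
proof
  assume R: "left_curve i j (pt x) C"
  then obtain u v where uv: "u \<in> F" "v \<in> F" "u < v" "F \<inter> {u<..<v} = {}" "C = pt ` {u<..<v}"
    unfolding left_curve_def critical_curve_iff by (auto elim!: gapsE)
  have "x \<in> {u..v}"
    using R uv(3,5) pt_in_closure_gap_iff unfolding left_curve_def by blast
  moreover have "\<forall>y\<in>{u<..<v}. y < x" using R uv(5) unfolding left_curve_def by auto
  then have "v \<le> x" using uv(3) by (meson dense_le_bounded greaterThanLessThan_iff less_imp_le)
  ultimately have "v = x" by simp
  then show "\<exists>u\<in>F. u < x \<and> F \<inter> {u<..<x} = {} \<and> C = pt ` {u<..<x}" using uv by blast
next
  assume "\<exists>u\<in>F. u < x \<and> F \<inter> {u<..<x} = {} \<and> C = pt ` {u<..<x}"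
  then obtain u where u: "u \<in> F" "u < x" "F \<inter> {u<..<x} = {}" "C = pt ` {u<..<x}" by blast
  then have "{u<..<x} \<in> gaps F" using assms unfolding gaps_def by blast
  then show "left_curve i j (pt x) C"
    using u unfolding left_curve_def critical_curve_iff by (auto simp: pt_in_closure_gap_iff)
qed

section \<open>Adjacent words as one-sided limits of boundary words\<close>

lemma right_word_r: "right_word i j (pt r) = None"
proof -
  have "\<not> r < v" if "v \<in> F" for v using that F_subset by (auto simp: not_less)
  then show ?thesis unfolding right_word_def right_curve_pt_iff[OF r_in_F] by auto
qed

lemma left_word_l: "left_word i j (pt l) = None"
proof -
  have "\<not> u < l" if "u \<in> F" for u using that F_subset by (auto simp: not_less)
  then show ?thesis unfolding left_word_def left_curve_pt_iff[OF l_in_F] by auto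
qed

text \<open>The right curve is unique because the successor of \<open>x\<close> in \<open>F\<close>
  is. The word is expressed through nearby \<open>y\<close>, so that its letters become one-sided
  limits that do not mention the successor.\<close>

lemma eventually_right_word:
  assumes "x \<in> F" "x \<noteq> r"
  shows "\<forall>\<^sub>F y in at_right x. right_word i j (pt x) = Some (W y)"
proof -
  have "x < r" using assms F_subset by force
  then obtain v where v: "v \<in> F" "x < v" "F \<inter> {x<..<v} = {}"
    using obtain_succ finite_F r_in_F by metis
  have C: "right_curve i j (pt x) C \<longleftrightarrow> C = pt ` {x<..<v}" for C
  proof
    assume "right_curve i j (pt x) C"
    then obtain v' where v': "v' \<in> F" "x < v'" "F \<inter> {x<..<v'} = {}" "C = pt ` {x<..<v'}"
      unfolding right_curve_pt_iff[OF assms(1)] by blast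
    then have "v' = v" using v by (metis disjoint_iff greaterThanLessThan_iff linorder_neqE)
    then show "C = pt ` {x<..<v}" using v' by simp
  qed (use v right_curve_pt_iff[OF assms(1)] in blast)
  have "right_word i j (pt x) = Some (W y)" if "y \<in> {x<..<v}" for y
    using curve_word_gap[OF assms(1) v(1,3) that] unfolding right_word_def C by simp
  then show ?thesis
    using eventually_at_right_real[OF v(2)] by (auto elim: eventually_mono)
qed

lemma eventually_left_word:
  assumes "x \<in> F" "x \<noteq> l"
  shows "\<forall>\<^sub>F y in at_left x. left_word i j (pt x) = Some (W y)"
proof -
  have "l < x" using assms F_subset by force
  then obtain u where u: "u \<in> F" "u < x" "F \<inter> {u<..<x} = {}"
    using obtain_pred finite_F l_in_F by metis
  have C: "left_curve i j (pt x) C \<longleftrightarrow> C = pt ` {u<..<x}" for C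
  proof
    assume "left_curve i j (pt x) C"
    then obtain u' where u': "u' \<in> F" "u' < x" "F \<inter> {u'<..<x} = {}" "C = pt ` {u'<..<x}"
      unfolding left_curve_pt_iff[OF assms(1)] by blast
    then have "u' = u" using u by (metis disjoint_iff greaterThanLessThan_iff linorder_neqE)
    then show "C = pt ` {u<..<x}" using u' by simp
  qed (use u left_curve_pt_iff[OF assms(1)] in blast)
  have "left_word i j (pt x) = Some (W y)" if "y \<in> {u<..<x}" for y
    using curve_word_gap[OF u(1) assms(1) u(3) that] unfolding left_word_def C by simp
  then show ?thesis
    using eventually_at_left_real[OF u(2)] by (auto elim: eventually_mono)
qed

text \<open>Just to the right of \<open>x\<close> the floor of \<open>k y\<close> is still that of
  \<open>k x\<close>, and the boundary moves faster than \<open>k y\<close> because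
  \<open>k < n\<close>. Equality at \<open>x\<close> hence becomes a strict inequality, which
  explains the non-strict sign on the right-hand side.\<close>

lemma eventually_frac_less_right:
  assumes "k < n"
  shows "\<forall>\<^sub>F y in at_right x. frac (real k * y) < real n * y - of_int J \<longleftrightarrow>
    frac (real k * x) \<le> real n * x - of_int J"
proof -
  let ?c = "real_of_int \<lfloor>real k * x\<rfloor>"
  have lim: "((\<lambda>y. real k * y) \<longlongrightarrow> real k * x) (at_right x)"
    "((\<lambda>y. real n * y - of_int J - (real k * y - ?c)) \<longlongrightarrow>
      real n * x - of_int J - (real k * x - ?c)) (at_right x)"
    by (intro tendsto_intros)+
  have ev1: "\<forall>\<^sub>F y in at_right x. real k * y < ?c + 1"
    by (intro order_tendstoD(2)[OF lim(1)]) linarith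
  have ev2: "\<forall>\<^sub>F y in at_right x. x < y" by (rule eventually_at_right_less)
  have ev3: "\<forall>\<^sub>F y in at_right x. real k * y - ?c < real n * y - of_int J \<longleftrightarrow>
      real k * x - ?c \<le> real n * x - of_int J"
  proof (cases "real k * x - ?c \<le> real n * x - of_int J")
    case True
    from ev2 show ?thesis
    proof eventually_elim
      case (elim y)
      have "0 < (real n - real k) * (y - x)" using elim assms by simp
      then show ?case using True by (simp add: algebra_simps)
    qed
  next
    case False
    have "\<forall>\<^sub>F y in at_right x. real n * y - of_int J - (real k * y - ?c) < 0"
      using False by (intro order_tendstoD(2)[OF lim(2)]) linarith
    then show ?thesis by eventually_elim (use False in linarith)
  qed
  from ev1 ev2 ev3 show ?thesis
  proof eventually_elim
    case (elim y)
    have "real k * x \<le> real k * y" using elim by (intro mult_left_mono) auto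
    then have "\<lfloor>real k * y\<rfloor> = \<lfloor>real k * x\<rfloor>" using elim by linarith
    then show ?case using elim(3) by (simp add: frac_def)
  qed
qed

text \<open>Moving left, the boundary recedes faster than \<open>k y\<close>, so equality at
  \<open>x\<close> fails to give a strict inequality. If \<open>k x\<close> is an integer,
  \<open>k y\<close> drops below it, as \<open>k > 0\<close>, and its fractional part tends to 1,
  which is never below the boundary.\<close>

lemma eventually_frac_less_left:
  assumes "0 < k" "k < n" "x \<in> {l..r}"
  shows "\<forall>\<^sub>F y in at_left x. frac (real k * y) < real n * y - of_int J \<longleftrightarrow>
    real k * x \<notin> \<int> \<and> frac (real k * x) < real n * x - of_int J"
proof -
  \<comment> \<open>the value of \<open>\<lfloor>k y\<rfloor>\<close> for \<open>y\<close> just to the left of \<open>x\<close>\<close>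
  define d where "d = \<lceil>real k * x\<rceil> - 1"
  let ?c = "real_of_int d"
  have lim: "((\<lambda>y. real k * y) \<longlongrightarrow> real k * x) (at_left x)"
    "((\<lambda>y. real n * y - of_int J - (real k * y - ?c)) \<longlongrightarrow>
      real n * x - of_int J - (real k * x - ?c)) (at_left x)"
    by (intro tendsto_intros)+
  have ev1: "\<forall>\<^sub>F y in at_left x. ?c < real k * y"
    unfolding d_def by (intro order_tendstoD(1)[OF lim(1)]) linarith
  have ev2: "\<forall>\<^sub>F y in at_left x. y < x" by (simp add: eventually_at_filter)
  have ev3: "\<forall>\<^sub>F y in at_left x. real k * y - ?c < real n * y - of_int J \<longleftrightarrow>
      real k * x - ?c < real n * x - of_int J"
  proof (cases "real k * x - ?c < real n * x - of_int J")
    case False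
    from ev2 show ?thesis
    proof eventually_elim
      case (elim y)
      have "0 < (real n - real k) * (x - y)" using elim assms by simp
      then show ?case using False by (simp add: algebra_simps)
    qed
  next
    case True
    have "\<forall>\<^sub>F y in at_left x. 0 < real n * y - of_int J - (real k * y - ?c)"
      using True by (intro order_tendstoD(1)[OF lim(2)]) linarith
    then show ?thesis by eventually_elim (use True in linarith)
  qed
  have limit: "real k * x - ?c < real n * x - of_int J \<longleftrightarrow>
      real k * x \<notin> \<int> \<and> frac (real k * x) < real n * x - of_int J"
  proof (cases "real k * x \<in> \<int>")
    case True
    \<comment> \<open>At an integer \<open>k x\<close> the fractional part has left limit 1, and the
      boundary is at most 1 because \<open>x\<close> lies in \<open>[l,r]\<close>.\<close>
    then have "real k * x - ?c = 1" by (auto simp: d_def elim!: Ints_cases)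
    then show ?thesis using True assms(3) unfolding in_interval_iff by auto
  next
    case False
    then have "d = \<lfloor>real k * x\<rfloor>" by (simp add: d_def ceiling_altdef Ints_def) (metis rangeI)
    then show ?thesis using False by (simp add: frac_def)
  qed
  from ev1 ev2 ev3 show ?thesis
  proof eventually_elim
    case (elim y)
    have "real k * y < real k * x" using elim assms(1) by simp
    then have "\<lfloor>real k * y\<rfloor> = d" using elim(1) unfolding d_def by linarith
    then show ?case using elim(3) limit by (simp add: frac_def)
  qed
qed

section \<open>Letters of the adjacent words\<close>

lemma a_neq_b: "a \<noteq> b" by (simp add: a_def b_def)

text \<open>Finitely many limit statements hold jointly, so a single \<open>y\<close> close to
  \<open>x\<close> serves all positions.\<close>

lemma right_word_letters:
  assumes "x \<in> F" "x \<noteq> r"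
  obtains w where "right_word i j (pt x) = Some w" "length w = n"
    "\<And>k. k < n \<Longrightarrow>
      w ! k = (if frac (real k * x) \<le> real n * x - of_int J then a else b)"
proof -
  have "\<forall>\<^sub>F y in at_right x. \<forall>k\<in>{..<n}. frac (real k * y) < real n * y - of_int J \<longleftrightarrow>
      frac (real k * x) \<le> real n * x - of_int J"
    by (intro eventually_ball_finite) (auto intro: eventually_frac_less_right)
  with eventually_right_word[OF assms]
  have "\<forall>\<^sub>F y in at_right x. right_word i j (pt x) = Some (W y) \<and>
      (\<forall>k\<in>{..<n}. frac (real k * y) < real n * y - of_int J \<longleftrightarrow>
        frac (real k * x) \<le> real n * x - of_int J)" by (rule eventually_conj)
  then obtain y where "right_word i j (pt x) = Some (W y)"
      "\<forall>k\<in>{..<n}. frac (real k * y) < real n * y - of_int J \<longleftrightarrow>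
        frac (real k * x) \<le> real n * x - of_int J"
    using eventually_happens'[OF trivial_limit_at_right_real] by blast
  then show thesis by (intro that[of "W y"]) (auto simp: prefix_def)
qed

text \<open>Position 0 is left out: the orbit point there is 0 for every \<open>y\<close> and does
  not jump to values near 1.\<close>

lemma left_word_letters:
  assumes "x \<in> F" "x \<noteq> l"
  obtains w where "left_word i j (pt x) = Some w" "length w = n"
    "\<And>k. 0 < k \<Longrightarrow> k < n \<Longrightarrow>
      w ! k = (if real k * x \<notin> \<int> \<and> frac (real k * x) < real n * x - of_int J then a else b)"
proof -
  have "x \<in> {l..r}" using assms F_subset by blast
  then have "\<forall>\<^sub>F y in at_left x. \<forall>k\<in>{0<..<n}. frac (real k * y) < real n * y - of_int J \<longleftrightarrow>
      real k * x \<notin> \<int> \<and> frac (real k * x) < real n * x - of_int J"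
    by (intro eventually_ball_finite) (auto intro: eventually_frac_less_left)
  with eventually_left_word[OF assms]
  have "\<forall>\<^sub>F y in at_left x. left_word i j (pt x) = Some (W y) \<and>
      (\<forall>k\<in>{0<..<n}. frac (real k * y) < real n * y - of_int J \<longleftrightarrow>
        real k * x \<notin> \<int> \<and> frac (real k * x) < real n * x - of_int J)" by (rule eventually_conj)
  then obtain y where "left_word i j (pt x) = Some (W y)"
      "\<forall>k\<in>{0<..<n}. frac (real k * y) < real n * y - of_int J \<longleftrightarrow>
        real k * x \<notin> \<int> \<and> frac (real k * x) < real n * x - of_int J"
    using eventually_happens'[OF trivial_limit_at_left_real] by blast
  then show thesis by (intro that[of "W y"]) (auto simp: prefix_def)
qed

section \<open>Congruences modulo the denominator and the three kinds of Farey points\<close>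

lemma frac_eq_0_iff_cong:
  assumes "q \<ge> 1" "coprime p q"
  shows "frac (real k * (real p / real q)) = 0 \<longleftrightarrow> [k = 0] (mod q)"
  using mult_fraction_in_Ints_iff[OF assms, of "int k"] by (simp add: cong_0_iff)

text \<open>A boundary in \<open>[0,1)\<close> is the fractional part of \<open>n\<theta>\<close>,
  so equality means that \<open>(k - n)\<theta>\<close> is an integer.\<close>

lemma frac_eq_boundary_iff_cong:
  assumes "q \<ge> 1" "coprime p q" "\<theta> = real p / real q"
    and "0 \<le> real n * \<theta> - of_int J" "real n * \<theta> - of_int J < 1"
  shows "frac (real k * \<theta>) = real n * \<theta> - of_int J \<longleftrightarrow> [k = n] (mod q)"
proof -
  have "real n * \<theta> - of_int J = frac (real n * \<theta> - of_int J)"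
    using assms(4,5) by (simp add: frac_eq)
  also have "\<dots> = frac (real n * \<theta>)" by (simp add: frac_eq_frac_iff)
  finally have "frac (real k * \<theta>) = real n * \<theta> - of_int J \<longleftrightarrow> real k * \<theta> - real n * \<theta> \<in> \<int>"
    by (simp add: frac_eq_frac_iff)
  also have "real k * \<theta> - real n * \<theta> = of_int (int k - int n) * \<theta>"
    by (simp add: algebra_simps)
  also have "\<dots> \<in> \<int> \<longleftrightarrow> int q dvd int k - int n"
    using mult_fraction_in_Ints_iff[OF assms(1,2)] assms(3) by blast
  also have "\<dots> \<longleftrightarrow> [k = n] (mod q)"
    by (simp add: cong_iff_dvd_diff flip: cong_int_iff)
  finally show ?thesis .
qed

text \<open>The boundary sits at 0: no point lies below it, and on the right exactly the times with
  fractional part 0 change letter, time 0 included.\<close>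

lemma words_at_l:
  assumes "q \<ge> 1" "coprime p q" "l = real p / real q"
  shows "boundary_word i (pt l) = replicate n b"
    "\<exists>wp. right_word i j (pt l) = Some wp \<and> length wp = n \<and>
       (\<forall>k\<in>{0..n - 1}. wp ! k = a \<longleftrightarrow> [k = 0] (mod q))"
proof -
  have 0: "real n * l - of_int J = 0" using n_pos by (simp add: l_eq)
  have "boundary_word i (pt l) = W l" using l_less_r by (simp add: boundary_word_pt)
  also have "\<dots> = replicate n b" unfolding prefix_def 0 by (simp add: not_less[THEN iffD2, OF frac_ge_0] map_replicate_const)
  finally show "boundary_word i (pt l) = replicate n b" .
  have "l \<noteq> r" using l_less_r by simp
  then obtain wp where wp: "right_word i j (pt l) = Some wp" "length wp = n"
    "\<And>k. k < n \<Longrightarrow> wp ! k = (if frac (real k * l) \<le> 0 then a else b)"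
    using right_word_letters[OF l_in_F] unfolding 0 by blast
  have "wp ! k = a \<longleftrightarrow> [k = 0] (mod q)" if "k \<in> {0..n - 1}" for k
  proof -
    have "k < n" using that n_pos by auto
    have "frac (real k * l) \<le> 0 \<longleftrightarrow> frac (real k * l) = 0" by (metis frac_ge_0 nle_le)
    then show ?thesis
      using wp(3)[OF \<open>k < n\<close>] a_neq_b frac_eq_0_iff_cong[OF assms(1,2)] assms(3) by auto
  qed
  then show "\<exists>wp. right_word i j (pt l) = Some wp \<and> length wp = n \<and>
       (\<forall>k\<in>{0..n - 1}. wp ! k = a \<longleftrightarrow> [k = 0] (mod q))" using wp by blast
qed

text \<open>The boundary sits at 1, so every point lies below it, and on the left only an integer
  \<open>k r\<close> spoils this.\<close>

lemma words_at_r: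
  assumes "q \<ge> 1" "coprime p q" "r = real p / real q"
  shows "boundary_word i (pt r) = replicate n a"
    "\<exists>wm. left_word i j (pt r) = Some wm \<and> length wm = n \<and>
       (\<forall>k\<in>{1..n - 1}. wm ! k = b \<longleftrightarrow> [k = 0] (mod q))"
proof -
  have 1: "real n * r - of_int J = 1" using n_pos by (simp add: r_eq)
  have "boundary_word i (pt r) = W r" using l_less_r by (simp add: boundary_word_pt)
  also have "\<dots> = replicate n a" unfolding prefix_def 1 by (simp add: frac_lt_1 map_replicate_const)
  finally show "boundary_word i (pt r) = replicate n a" .
  have "r \<noteq> l" using l_less_r by simp
  then obtain wm where wm: "left_word i j (pt r) = Some wm" "length wm = n"
    "\<And>k. 0 < k \<Longrightarrow> k < n \<Longrightarrow> wm ! k = (if real k * r \<notin> \<int> \<and> frac (real k * r) < 1 then a else b)"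
    using left_word_letters[OF r_in_F] unfolding 1 by blast
  have "wm ! k = b \<longleftrightarrow> [k = 0] (mod q)" if "k \<in> {1..n - 1}" for k
  proof -
    have "0 < k" "k < n" using that by auto
    then show ?thesis
      using wm(3) a_neq_b frac_eq_0_iff_cong[OF assms(1,2)] assms(3) by (auto simp: frac_lt_1)
  qed
  then show "\<exists>wm. left_word i j (pt r) = Some wm \<and> length wm = n \<and>
       (\<forall>k\<in>{1..n - 1}. wm ! k = b \<longleftrightarrow> [k = 0] (mod q))" using wm by blast
qed

text \<open>Let \<open>f\<close> be the fractional part of \<open>k\<theta>\<close>. The letters on
  the left, at the point and on the right are \<open>b a a\<close> for \<open>f = 0\<close>,
  \<open>a a a\<close> for \<open>0 < f < \<rho>\<close>, \<open>b b a\<close> for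
  \<open>f = \<rho>\<close> and \<open>b b b\<close> for \<open>f > \<rho>\<close>. Here \<rho> is
  the normalised boundary, strictly between 0 and 1, so the four cases are disjoint.\<close>

lemma words_inside:
  assumes "q \<ge> 1" "coprime p q" "\<theta> = real p / real q" "\<theta> \<in> F" "\<theta> \<noteq> l" "\<theta> \<noteq> r"
  shows "\<exists>wm wp. left_word i j (pt \<theta>) = Some wm \<and> length wm = n \<and>
     right_word i j (pt \<theta>) = Some wp \<and> length wp = n \<and>
     (\<forall>k\<in>{1..n - 1}.
        (W \<theta> ! k = b \<and> wm ! k = W \<theta> ! k \<and> W \<theta> ! k \<noteq> wp ! k \<longleftrightarrow> [k = n] (mod q)) \<and>
        (W \<theta> ! k = a \<and> wm ! k \<noteq> W \<theta> ! k \<and> W \<theta> ! k = wp ! k \<longleftrightarrow> [k = 0] (mod q)))"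
proof -
  define \<rho> where "\<rho> = real n * \<theta> - of_int J"
  have "l < \<theta>" "\<theta> < r" using assms(4-6) F_subset by force+
  then have \<rho>: "0 < \<rho>" "\<rho> < 1"
    using n_pos unfolding \<rho>_def l_eq r_eq by (auto simp: field_simps)
  obtain wm where wm: "left_word i j (pt \<theta>) = Some wm" "length wm = n"
    "\<And>k. 0 < k \<Longrightarrow> k < n \<Longrightarrow>
      wm ! k = (if real k * \<theta> \<notin> \<int> \<and> frac (real k * \<theta>) < \<rho> then a else b)"
    using left_word_letters[OF assms(4,5)] unfolding \<rho>_def by blast
  obtain wp where wp: "right_word i j (pt \<theta>) = Some wp" "length wp = n"
    "\<And>k. k < n \<Longrightarrow> wp ! k = (if frac (real k * \<theta>) \<le> \<rho> then a else b)"
    using right_word_letters[OF assms(4,6)] unfolding \<rho>_def by blast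
  have "(W \<theta> ! k = b \<and> wm ! k = W \<theta> ! k \<and> W \<theta> ! k \<noteq> wp ! k \<longleftrightarrow> [k = n] (mod q)) \<and>
        (W \<theta> ! k = a \<and> wm ! k \<noteq> W \<theta> ! k \<and> W \<theta> ! k = wp ! k \<longleftrightarrow> [k = 0] (mod q))"
    if k: "k \<in> {1..n - 1}" for k
  proof -
    have kn: "0 < k" "k < n" using k by auto
    define f where "f = frac (real k * \<theta>)"
    have w: "W \<theta> ! k = (if f < \<rho> then a else b)"
      using kn by (simp add: prefix_def \<rho>_def f_def)
    have wm_k: "wm ! k = (if f \<noteq> 0 \<and> f < \<rho> then a else b)"
      using wm(3)[OF kn] unfolding f_def by simp
    have wp_k: "wp ! k = (if f \<le> \<rho> then a else b)"
      using wp(3)[OF kn(2)] unfolding f_def .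
    have f_eq_\<rho>: "[k = n] (mod q) \<longleftrightarrow> f = \<rho>"
      using frac_eq_boundary_iff_cong[OF assms(1-3)] \<rho> unfolding \<rho>_def f_def by simp
    have f_eq_0: "[k = 0] (mod q) \<longleftrightarrow> f = 0"
      using frac_eq_0_iff_cong[OF assms(1,2)] assms(3) unfolding f_def by simp
    show ?thesis
      unfolding w wm_k wp_k f_eq_\<rho> f_eq_0 using a_neq_b \<rho> by auto
  qed
  then show ?thesis using wm wp by blast
qed

end

theorem theorem1:
  fixes i j :: int and n :: nat and F :: "real set" and a b :: letter
  assumes "chain_index i j"
    and "n = nat \<bar>i\<bar>" and "n \<ge> 1"
    and "F = farey n \<inter> {theta_minus i j..theta_plus i j}"
    and "a = (if i > 0 then La else Lb)" and "b = (if i > 0 then Lb else La)"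
  shows
    "partition_on (chain i j) ({C. critical_curve i j C} \<union> {{P} | P. farey_point i j P})
     \<and> finite F
     \<and> card {P. farey_point i j P} = card F
     \<and> card {C. critical_curve i j C} = card F - 1
     \<and> {P. farey_point i j P} = {P \<in> chain i j. fst P \<in> F}
     \<and> {C. critical_curve i j C} =
         {open_segment P Q | P Q. P \<in> chain i j \<and> Q \<in> chain i j \<and> fst P \<in> F \<and> fst Q \<in> F
            \<and> fst P < fst Q \<and> F \<inter> {fst P<..<fst Q} = {}}
     \<and>
     (\<forall>(p::nat) (q::nat) \<theta> P w. q \<ge> 1 \<and> coprime p q \<and> \<theta> = real p / real q \<and> \<theta> \<in> F
        \<and> P \<in> chain i j \<and> fst P = \<theta> \<and> w = boundary_word i P \<longrightarrow>
       (\<theta> = theta_minus i j \<longrightarrow>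
          left_word i j P = None \<and>
          (\<exists>wp. right_word i j P = Some wp \<and> length wp = n \<and>
             w = replicate n b \<and>
             (\<forall>k\<in>{0..n - 1}. wp ! k = a \<longleftrightarrow> [k = 0] (mod q)))) \<and>
       (\<theta> = theta_plus i j \<longrightarrow>
          right_word i j P = None \<and>
          (\<exists>wm. left_word i j P = Some wm \<and> length wm = n \<and>
             w = replicate n a \<and>
             (\<forall>k\<in>{1..n - 1}. wm ! k = b \<longleftrightarrow> [k = 0] (mod q)))) \<and>
       (\<theta> \<noteq> theta_minus i j \<and> \<theta> \<noteq> theta_plus i j \<longrightarrow>
          (\<exists>wm wp. left_word i j P = Some wm \<and> length wm = n \<and>
             right_word i j P = Some wp \<and> length wp = n \<and>
             (\<forall>k\<in>{1..n - 1}.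
                ((w ! k = b \<and> wm ! k = w ! k \<and> w ! k \<noteq> wp ! k) \<longleftrightarrow> [k = n] (mod q)) \<and>
                ((w ! k = a \<and> wm ! k \<noteq> w ! k \<and> w ! k = wp ! k) \<longleftrightarrow> [k = 0] (mod q))))))"
proof -
  interpret nonzero_chain i j
    using assms(1-3) by unfold_locales auto
  \<comment> \<open>The data of the theorem agree with those of the normalised chain, which the
    qualified names denote.\<close>
  have eqs: "n = nonzero_chain.n i" "F = nonzero_chain.F i j" "a = nonzero_chain.a i"
    "b = nonzero_chain.b i"
    using assms(2,4-6) unfolding n_def a_def b_def F_def l_def r_def by auto
  \<comment> \<open>A point of the chain is determined by its rotation number, so the claims on
    words can be stated for \<open>pt \<theta>\<close>.\<close>
  have at: "P = pt \<theta>" "q \<ge> 1" "coprime p q" "\<theta> = real p / real q" "\<theta> \<in> nonzero_chain.F i j"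
      "w = boundary_word i (pt \<theta>)" "w = W \<theta>"
    if "q \<ge> 1 \<and> coprime p q \<and> \<theta> = real p / real q \<and> \<theta> \<in> nonzero_chain.F i j
        \<and> P \<in> chain i j \<and> fst P = \<theta> \<and> w = boundary_word i P"
    for p q :: nat and \<theta> P w
  proof -
    show P: "P = pt \<theta>" using that pt_fst(1)[of P] by simp
    show F: "\<theta> \<in> nonzero_chain.F i j" using that by blast
    show w: "w = boundary_word i (pt \<theta>)" using that P by simp
    show "w = W \<theta>" unfolding w using F F_subset by (intro boundary_word_pt) blast
  qed (use that in blast)+
  \<comment> \<open>Cases 1 to 6 form part (i); 7 and 8 concern the left endpoint, 9 and 10 the
    right one, and 11 the Farey points between them.\<close>
  show ?thesis
    unfolding eqs
  proof (intro conjI allI impI, goal_cases)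
    case 1
    show ?case by (rule partition_on_chain)
  next
    case 2
    show ?case by (rule finite_F)
  next
    case 3
    show ?case by (rule card_farey_points)
  next
    case 4
    show ?case by (rule card_critical_curves)
  next
    case 5
    show ?case by (rule farey_points)
  next
    case 6
    show ?case by (rule critical_curves)
  next
    case (7 p q \<theta> P w)
    then show ?case using at(1)[OF 7(1)] left_word_l unfolding l_def by simp
  next
    case (8 p q \<theta> P w)
    then have "\<theta> = l" by (simp add: l_def)
    then show ?case using words_at_l[OF at(2,3)[OF 8(1)]] at[OF 8(1)] by metis
  next
    case (9 p q \<theta> P w)
    then show ?case using at(1)[OF 9(1)] right_word_r unfolding r_def by simp
  next
    case (10 p q \<theta> P w)
    then have "\<theta> = r" by (simp add: r_def)
    then show ?case using words_at_r[OF at(2,3)[OF 10(1)]] at[OF 10(1)] by metis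
  next
    case (11 p q \<theta> P w)
    then have "\<theta> \<noteq> l" "\<theta> \<noteq> r" by (simp_all add: l_def r_def)
    then show ?case
      using words_inside[OF at(2-5)[OF 11(1)]] unfolding at(1,7)[OF 11(1)] by blast
  qed
qed

end
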